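(* Any non-proximal, transitive compact system $(X,T)$ is thickly sensitive.
   Context: A dynamical system $(X,T)$ consists of a nonempty compact metric space $X$ (metric $d$) and a continuous surjective map $T:X\to X$; by standing assumption $X$ has no isolated points and is not a singleton. $\mathbb{Z}_+$ is the set of nonnegative integers. "Opene" means open and nonempty. For opene $U,V\subset X$ put $N_T(U,V)=\{n\in\mathbb{Z}_+: U\cap T^{-n}V\neq\varnothing\}$, and for $x\in X$, $G\subset X$ put $N_T(x,G)=\{n\in\mathbb{Z}_+: T^nx\in G\}$. The system is transitive compact if for every $x\in X$ there is $z\in X$ such that $N_T(x,G)\cap N_T(U,V)\neq\varnothing$ for every neighborhood $G$ of $z$ and all opene $U,V\subset X$. A pair $x,y\in X$ is proximal if $\liminf_{n\to\infty}d(T^nx,T^ny)=0$; the system is proximal if every pair in $X\times X$ is proximal. For $\delta>0$ and opene $U\subset X$, $S_T(U,\delta)=\{n\in\mathbb{Z}_+:\text{there are }x_1,x_2\in U\text{ with }d(T^nx_1,T^nx_2)>\delta\}$. A subset of $\mathbb{Z}_+$ is thick if it contains arbitrarily long runs of consecutive positive integers. The system is thickly sensitive if there is $\delta>0$ such that $S_T(U,\delta)$ is thick for every opene $U\subset X$. *)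

theory Defs
  imports "HOL-Analysis.Analysis"
begin

text \<open>The phase space is a carrier set \<open>X\<close> in a metric type, with the restricted metric; all
  topological notions are relative to \<open>X\<close>. The values of \<open>T\<close> outside \<open>X\<close> play no role, since all
  sets of points below are subsets of \<open>X\<close> and \<open>T\<close> maps \<open>X\<close> onto itself. The time set
  of nonnegative integers is \<^typ>\<open>nat\<close>, including 0.\<close>

definition dynamical_system :: "'a::metric_space set \<Rightarrow> ('a \<Rightarrow> 'a) \<Rightarrow> bool" where
  "dynamical_system X T \<longleftrightarrow>
     X \<noteq> {} \<and> compact X \<and> continuous_on X T \<and> T ` X = X \<and>
     (\<forall>x\<in>X. x islimpt X) \<and> \<not> is_singleton X"

definition opene :: "'a::metric_space set \<Rightarrow> 'a set \<Rightarrow> bool" where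
  "opene X U \<longleftrightarrow> openin (top_of_set X) U \<and> U \<noteq> {}"

text \<open>Neighborhoods need not be open.\<close>

definition neighborhood :: "'a::metric_space set \<Rightarrow> 'a \<Rightarrow> 'a set \<Rightarrow> bool" where
  "neighborhood X z G \<longleftrightarrow>
     G \<subseteq> X \<and> (\<exists>W. openin (top_of_set X) W \<and> z \<in> W \<and> W \<subseteq> G)"

definition hit_sets :: "('a \<Rightarrow> 'a) \<Rightarrow> 'a set \<Rightarrow> 'a set \<Rightarrow> nat set" where
  "hit_sets T U V = {n. U \<inter> (T ^^ n) -` V \<noteq> {}}"

definition hit_point :: "('a \<Rightarrow> 'a) \<Rightarrow> 'a \<Rightarrow> 'a set \<Rightarrow> nat set" where
  "hit_point T x G = {n. (T ^^ n) x \<in> G}"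

definition transitive_compact :: "'a::metric_space set \<Rightarrow> ('a \<Rightarrow> 'a) \<Rightarrow> bool" where
  "transitive_compact X T \<longleftrightarrow>
     (\<forall>x\<in>X. \<exists>z\<in>X. \<forall>G U V. neighborhood X z G \<and> opene X U \<and> opene X V \<longrightarrow>
        hit_point T x G \<inter> hit_sets T U V \<noteq> {})"

definition proximal_pair :: "('a::metric_space \<Rightarrow> 'a) \<Rightarrow> 'a \<Rightarrow> 'a \<Rightarrow> bool" where
  "proximal_pair T x y \<longleftrightarrow> liminf (\<lambda>n. ereal (dist ((T ^^ n) x) ((T ^^ n) y))) = 0"

definition proximal_system :: "'a::metric_space set \<Rightarrow> ('a \<Rightarrow> 'a) \<Rightarrow> bool" where
  "proximal_system X T \<longleftrightarrow> (\<forall>x\<in>X. \<forall>y\<in>X. proximal_pair T x y)"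

definition sensitivity_times :: "('a::metric_space \<Rightarrow> 'a) \<Rightarrow> 'a set \<Rightarrow> real \<Rightarrow> nat set" where
  "sensitivity_times T U \<delta> =
     {n. \<exists>x\<^sub>1\<in>U. \<exists>x\<^sub>2\<in>U. dist ((T ^^ n) x\<^sub>1) ((T ^^ n) x\<^sub>2) > \<delta>}"

definition thick :: "nat set \<Rightarrow> bool" where
  "thick A \<longleftrightarrow> (\<forall>k. \<exists>n\<ge>1. {n..n + k} \<subseteq> A)"

definition thickly_sensitive :: "'a::metric_space set \<Rightarrow> ('a \<Rightarrow> 'a) \<Rightarrow> bool" where
  "thickly_sensitive X T \<longleftrightarrow>
     (\<exists>\<delta>>0. \<forall>U. opene X U \<longrightarrow> thick (sensitivity_times T U \<delta>))"

end

theory Submission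
  imports Defs
begin

text \<open>
  Why it is true. Suppose that at some time \<open>n\<close> an opene set \<open>U\<close> has one point close to \<open>a\<close> and another
  close to \<open>b\<close>. If the orbits of \<open>a\<close> and \<open>b\<close> stay apart for \<open>k\<close> further steps, then
  by continuity \<open>n, \<dots>, n + k\<close> are sensitivity times of \<open>U\<close>. So a run of length \<open>k\<close> needs two things:
  a pair \<open>a\<close>, \<open>b\<close> whose orbits stay apart for \<open>k\<close> steps, and a common time at which \<open>U\<close> visits
  any prescribed small neighborhoods of both. Common visits are what weak mixing would provide;
  transitive compactness provides them when one of the two targets lies on a special orbit.

  Common visits (\<open>simultaneous_hitting\<close>). Transitive compactness implies transitivity, so by
  Baire's theorem there is a point \<open>u\<close> whose orbit enters every opene set
  (\<open>exists_transitive_point\<close>). Let \<open>z\<close> be the point that transitive compactness assigns to \<open>u\<close>. If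
  the orbit of \<open>u\<close> enters \<open>U\<close> at time \<open>m\<close>, then for every \<open>j > m\<close>, every neighborhood of
  \<open>T\<^sup>j z\<close> and every opene \<open>V\<close> there is a common time at which \<open>U\<close> visits both. The orbit of \<open>z\<close> serves all
  \<open>U\<close> at once, which is what makes a sensitivity constant independent of \<open>U\<close> possible.

  Separated pairs (\<open>not_proximal_pair_imp_escape\<close>). It remains to find, for each \<open>k\<close>, late points
  \<open>T\<^sup>j z\<close> whose orbits stay away from that of some \<open>v\<close> for \<open>k\<close> steps, by a distance independent of
  \<open>k\<close>. Let \<open>(x, y)\<close> be a non-proximal pair. If \<open>(z, x)\<close> is not proximal either, \<open>v = T\<^sup>j x\<close> works
  for all late \<open>j\<close>. If it is proximal, then there are late \<open>j\<close> from which the orbit of \<open>z\<close> shadows that of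
  \<open>x\<close> for \<open>k\<close> steps, and since \<open>x\<close> and \<open>y\<close> stay apart, \<open>v = T\<^sup>j y\<close> works.
\<close>

section \<open>Iterates of a continuous surjection\<close>

lemma image_funpow_self:
  assumes "T ` X = X"
  shows "(T ^^ n) ` X = X"
proof (induction n)
  case (Suc n)
  have "(T ^^ Suc n) ` X = T ` ((T ^^ n) ` X)" by (simp add: image_comp)
  then show ?case using Suc assms by simp
qed simp

lemma funpow_mem:
  assumes "T ` X = X" "x \<in> X"
  shows "(T ^^ n) x \<in> X"
  using imageI[OF assms(2), of "T ^^ n"] image_funpow_self[OF assms(1), of n] by simp

lemma continuous_on_funpow:
  fixes T :: "'a::topological_space \<Rightarrow> 'a"
  assumes "continuous_on X T" "T ` X = X"
  shows "continuous_on X (T ^^ n)"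
proof (induction n)
  case (Suc n)
  have "continuous_on ((T ^^ n) ` X) T"
    using assms by (simp add: image_funpow_self)
  from continuous_on_compose[OF Suc this] show ?case by simp
qed simp

lemma openin_vimage_funpow:
  fixes T :: "'a::metric_space \<Rightarrow> 'a"
  assumes "continuous_on X T" "T ` X = X" "openin (top_of_set X) V"
  shows "openin (top_of_set X) (X \<inter> (T ^^ n) -` V)"
proof (rule continuous_openin_preimage[OF continuous_on_funpow[OF assms(1,2)] _ assms(3)])
  show "(T ^^ n) \<in> X \<rightarrow> X" using funpow_mem[OF assms(2)] by simp
qed

lemma opene_vimage_funpow:
  fixes T :: "'a::metric_space \<Rightarrow> 'a"
  assumes "continuous_on X T" "T ` X = X" "opene X V"
  shows "opene X (X \<inter> (T ^^ n) -` V)"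
proof -
  obtain v where "v \<in> V" "v \<in> X"
    using assms(3) openin_imp_subset unfolding opene_def by blast
  moreover from this obtain w where "w \<in> X" "(T ^^ n) w = v"
    using image_funpow_self[OF assms(2), of n] by (metis imageE)
  ultimately have "X \<inter> (T ^^ n) -` V \<noteq> {}" by blast
  then show ?thesis
    using assms openin_vimage_funpow[of X T V n] by (simp add: opene_def)
qed

lemma opene_Int_ball:
  assumes "a \<in> X" "0 < r"
  shows "opene X (X \<inter> ball a r)"
  using assms by (auto simp: opene_def openin_open)

section \<open>Transitive points\<close>

text \<open>Finite covers by balls of radius \<open>1 / (n + 1)\<close>, taken over all \<open>n\<close>, give the countable family; a ball
  of radius less than \<open>e / 2\<close> that contains \<open>p\<close> lies within \<open>e\<close> of \<open>p\<close>.\<close>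

lemma compact_imp_countable_base:
  fixes X :: "'a::metric_space set"
  assumes "compact X"
  obtains \<B> where "countable \<B>" "\<And>B. B \<in> \<B> \<Longrightarrow> opene X B"
    "\<And>U. opene X U \<Longrightarrow> \<exists>B\<in>\<B>. B \<subseteq> U"
proof -
  have "\<exists>F. finite F \<and> F \<subseteq> X \<and> X \<subseteq> (\<Union>x\<in>F. ball x (inverse (Suc n)))" for n
    using compact_imp_seq_compact[OF assms] seq_compact_imp_totally_bounded
    by (metis inverse_positive_iff_positive of_nat_0_less_iff zero_less_Suc)
  then obtain F where F: "\<And>n. finite (F n)" "\<And>n. F n \<subseteq> X"
    "\<And>n. X \<subseteq> (\<Union>x\<in>F n. ball x (inverse (Suc n)))"
    by metis
  define \<B> where "\<B> = (\<Union>n. (\<lambda>x. X \<inter> ball x (inverse (Suc n))) ` F n)"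
  show thesis
  proof
    show "countable \<B>"
      unfolding \<B>_def by (intro countable_UN countable_image countable_finite F(1) countableI_type)
    show "opene X B" if "B \<in> \<B>" for B
      using that F(2) unfolding \<B>_def
      by (auto simp del: of_nat_Suc intro!: opene_Int_ball)
    fix U assume "opene X U"
    then obtain p where p: "p \<in> U" and U: "openin (top_of_set X) U"
      unfolding opene_def by blast
    then obtain e where e: "e > 0" "X \<inter> ball p e \<subseteq> U"
      by (metis Int_commute openin_contains_ball)
    obtain n where n: "inverse (real (Suc n)) < e / 2"
      using reals_Archimedean[of "e/2"] e by auto
    have "p \<in> X" using p U openin_imp_subset by blast
    then obtain x where x: "x \<in> F n" "p \<in> ball x (inverse (Suc n))"
      using F(3)[of n] by blast
    have "ball x (inverse (Suc n)) \<subseteq> ball p e"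
    proof
      fix q assume "q \<in> ball x (inverse (Suc n))"
      then have "dist p q < e"
        using x(2) n dist_triangle[of p q x] by (simp add: dist_commute)
      then show "q \<in> ball p e" by simp
    qed
    then have "X \<inter> ball x (inverse (Suc n)) \<subseteq> U" using e by blast
    moreover have "X \<inter> ball x (inverse (Suc n)) \<in> \<B>" using x unfolding \<B>_def by blast
    ultimately show "\<exists>B\<in>\<B>. B \<subseteq> U" by blast
  qed
qed

text \<open>For each basic set \<open>B\<close> the points whose orbit meets \<open>B\<close> form an open set, which is dense by
  transitivity. The Baire category theorem gives a point in all these countably many sets.\<close>

lemma exists_transitive_point:
  fixes X :: "'a::metric_space set"
  assumes "compact X" "X \<noteq> {}" "continuous_on X T" "T ` X = X"
    and trans: "\<And>U V. opene X U \<Longrightarrow> opene X V \<Longrightarrow> hit_sets T U V \<noteq> {}"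
  obtains u where "u \<in> X" "\<And>U. opene X U \<Longrightarrow> \<exists>m. (T ^^ m) u \<in> U"
proof -
  obtain \<B> where \<B>: "countable \<B>" "\<And>B. B \<in> \<B> \<Longrightarrow> opene X B"
    "\<And>U. opene X U \<Longrightarrow> \<exists>B\<in>\<B>. B \<subseteq> U"
    using compact_imp_countable_base[OF assms(1)] by metis
  define A where "A B = (\<Union>n. X \<inter> (T ^^ n) -` B)" for B
  have ope: "openin (top_of_set X) (A B)" if "B \<in> \<B>" for B
    unfolding A_def using \<B>(2)[OF that] assms(3,4)
    by (intro openin_Union) (auto simp: opene_def intro: openin_vimage_funpow)
  have dense: "top_of_set X closure_of A B = X" if "B \<in> \<B>" for B
  proof -
    have "A B \<inter> U \<noteq> {}" if "openin (top_of_set X) U" "U \<noteq> {}" for U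
    proof -
      have "opene X U" using that by (simp add: opene_def)
      then have "hit_sets T U B \<noteq> {}" using trans \<B>(2)[OF \<open>B \<in> \<B>\<close>] by simp
      then obtain n where "U \<inter> (T ^^ n) -` B \<noteq> {}"
        unfolding hit_sets_def by auto
      moreover have "U \<subseteq> X" using openin_imp_subset[OF that(1)] .
      ultimately show ?thesis unfolding A_def by blast
    qed
    then show ?thesis
      using dense_intersects_open[of "top_of_set X" "A B"] by simp
  qed
  have "top_of_set X closure_of \<Inter>(A ` \<B>) = topspace (top_of_set X)"
  proof (rule Baire_category)
    have "compact_space (top_of_set X)"
      using assms(1) by (simp add: compact_space_subtopology)
    moreover have "Hausdorff_space (top_of_set X)"
      by (simp add: Hausdorff_space_subtopology)
    ultimately show "completely_metrizable_space (top_of_set X) \<or>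
        locally_compact_space (top_of_set X) \<and> regular_space (top_of_set X)"
      using compact_Hausdorff_imp_regular_space compact_imp_locally_compact_space by blast
  qed (use \<B>(1) ope dense in auto)
  then have "\<Inter>(A ` \<B>) \<inter> X \<noteq> {}"
    using dense_intersects_open[of "top_of_set X" "\<Inter>(A ` \<B>)"] assms(2) by simp
  then obtain u where u: "u \<in> X" "u \<in> \<Inter>(A ` \<B>)" by blast
  show thesis
  proof
    show "\<exists>m. (T ^^ m) u \<in> U" if U: "opene X U" for U
    proof -
      obtain B where "B \<in> \<B>" "B \<subseteq> U" using \<B>(3)[OF U] by blast
      then show ?thesis using u(2) unfolding A_def by blast
    qed
  qed (fact u(1))
qed

section \<open>Orbit segments that stay apart\<close>

lemma not_proximal_pair_imp_apart:
  assumes "\<not> proximal_pair T x y"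
  obtains e where "e > 0" "\<forall>\<^sub>F n in sequentially. e < dist ((T ^^ n) x) ((T ^^ n) y)"
proof -
  let ?L = "liminf (\<lambda>n. ereal (dist ((T ^^ n) x) ((T ^^ n) y)))"
  have "0 \<le> ?L" by (intro Liminf_bounded) auto
  then have "0 < ?L" using assms unfolding proximal_pair_def by auto
  then obtain e where e: "0 < ereal e" "ereal e < ?L"
    using ereal_dense2[OF \<open>0 < ?L\<close>] by blast
  then have "\<forall>\<^sub>F n in sequentially. ereal e < ereal (dist ((T ^^ n) x) ((T ^^ n) y))"
    using less_LiminfD by blast
  then show thesis using e that by simp
qed

lemma uniformly_close_iterates:
  fixes X :: "'a::metric_space set"
  assumes "compact X" "continuous_on X T" "T ` X = X" "0 < e"
  obtains d where "d > 0"
    "\<And>a b i. \<lbrakk>a \<in> X; b \<in> X; dist a b < d; i \<le> k\<rbrakk> \<Longrightarrow> dist ((T ^^ i) a) ((T ^^ i) b) < e"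
proof -
  have "\<exists>d>0. \<forall>a\<in>X. \<forall>b\<in>X. dist a b < d \<longrightarrow> dist ((T ^^ i) a) ((T ^^ i) b) < e" for i
    using compact_uniformly_continuous[OF continuous_on_funpow[OF assms(2,3)] assms(1), of i] assms(4)
    unfolding uniformly_continuous_on_def by (metis dist_commute)
  then obtain d where d: "\<And>i. d i > 0"
    "\<And>i a b. \<lbrakk>a \<in> X; b \<in> X; dist a b < d i\<rbrakk> \<Longrightarrow> dist ((T ^^ i) a) ((T ^^ i) b) < e"
    by metis
  show thesis
  proof
    show "Min (d ` {..k}) > 0" using d(1) by simp
    show "dist ((T ^^ i) a) ((T ^^ i) b) < e"
      if "a \<in> X" "b \<in> X" "dist a b < Min (d ` {..k})" "i \<le> k" for a b i
    proof -
      have "Min (d ` {..k}) \<le> d i" using that(4) by simp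
      then show ?thesis using d(2)[of a b i] that by linarith
    qed
  qed
qed

text \<open>A point \<open>z\<close> cannot stay close for long to both members of a non-proximal pair.
  The constant \<open>\<delta>\<close> does not depend on \<open>k\<close>, but \<open>j\<close> and \<open>v\<close> may: only this freedom lets a
  proximal pair \<open>(z, x)\<close> help, because the orbit of \<open>z\<close> then shadows that of \<open>x\<close> on
  segments of every finite length, starting at a time that depends on the length.\<close>

lemma not_proximal_pair_imp_escape:
  fixes X :: "'a::metric_space set"
  assumes "compact X" "continuous_on X T" "T ` X = X"
    and "x \<in> X" "y \<in> X" "z \<in> X" "\<not> proximal_pair T x y"
  obtains \<delta> where "\<delta> > 0"
    "\<And>k m. \<exists>j>m. \<exists>v\<in>X. \<forall>i\<le>k. \<delta> < dist ((T ^^ (i + j)) z) ((T ^^ i) v)"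
proof (cases "proximal_pair T z x")
  case False
  then obtain e where e: "e > 0" "\<forall>\<^sub>F n in sequentially. e < dist ((T ^^ n) z) ((T ^^ n) x)"
    by (rule not_proximal_pair_imp_apart)
  then obtain N where N: "\<And>n. n \<ge> N \<Longrightarrow> e < dist ((T ^^ n) z) ((T ^^ n) x)"
    unfolding eventually_sequentially by blast
  show thesis
  proof (rule that[OF e(1)])
    fix k m
    obtain j where j: "j > m" "j \<ge> N" using that[of "Suc (max m N)"] by simp
    then have "\<forall>i\<le>k. e < dist ((T ^^ (i + j)) z) ((T ^^ i) ((T ^^ j) x))"
      using N[of "_ + j"] by (simp add: funpow_add)
    then show "\<exists>j>m. \<exists>v\<in>X. \<forall>i\<le>k. e < dist ((T ^^ (i + j)) z) ((T ^^ i) v)"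
      using j(1) funpow_mem[OF assms(3,4), of j] by blast
  qed
next
  case True
  obtain e where e: "e > 0" "\<forall>\<^sub>F n in sequentially. e < dist ((T ^^ n) x) ((T ^^ n) y)"
    using assms(7) by (rule not_proximal_pair_imp_apart)
  then obtain N where N: "\<And>n. n \<ge> N \<Longrightarrow> e < dist ((T ^^ n) x) ((T ^^ n) y)"
    unfolding eventually_sequentially by blast
  show thesis
  proof (rule that[of "e/2"])
    fix k m
    obtain d where d: "d > 0"
      "\<And>a b i. \<lbrakk>a \<in> X; b \<in> X; dist a b < d; i \<le> k\<rbrakk> \<Longrightarrow> dist ((T ^^ i) a) ((T ^^ i) b) < e / 2"
      using uniformly_close_iterates[OF assms(1-3), of "e/2" k] e(1) by auto
    \<comment> \<open>Proximality makes the two orbits \<open>d\<close>-close at arbitrarily late times, and the choice of \<open>d\<close>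
      turns one such time into \<open>k\<close> steps of shadowing.\<close>
    obtain j where j: "j > max m N" "dist ((T ^^ j) z) ((T ^^ j) x) < d"
    proof (rule ccontr)
      assume "\<not> thesis"
      then have "\<forall>\<^sub>F n in sequentially. ereal d \<le> ereal (dist ((T ^^ n) z) ((T ^^ n) x))"
        unfolding eventually_sequentially using that
        by (metis Suc_le_eq ereal_less_eq(3) not_le)
      then have "ereal d \<le> liminf (\<lambda>n. ereal (dist ((T ^^ n) z) ((T ^^ n) x)))"
        by (rule Liminf_bounded)
      then show False using True d(1) unfolding proximal_pair_def by simp
    qed
    have "e / 2 < dist ((T ^^ (i + j)) z) ((T ^^ i) ((T ^^ j) y))" if "i \<le> k" for i
    proof -
      have "dist ((T ^^ (i + j)) z) ((T ^^ (i + j)) x) < e / 2"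
        using d(2)[OF _ _ j(2) that] funpow_mem[OF assms(3)] assms(4,6) by (simp add: funpow_add)
      moreover have "e < dist ((T ^^ (i + j)) x) ((T ^^ (i + j)) y)"
        using N j(1) by simp
      ultimately show ?thesis
        using dist_triangle2[of "(T ^^ (i + j)) x" "(T ^^ (i + j)) y" "(T ^^ (i + j)) z"]
        by (simp add: funpow_add dist_commute)
    qed
    then show "\<exists>j>m. \<exists>v\<in>X. \<forall>i\<le>k. e / 2 < dist ((T ^^ (i + j)) z) ((T ^^ i) v)"
      using j(1) funpow_mem[OF assms(3,5)] by (metis max_less_iff_conj)
  qed (use e in simp)
qed

section \<open>Common visits to two targets\<close>

text \<open>Transitive compactness for \<open>u\<close> speaks of the times at which \<open>u\<close> itself is near \<open>z\<close>. Applied to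
  the preimages of \<open>G\<close> under \<open>T\<^sup>j\<close> and of \<open>V\<close> under \<open>T\<^sup>j\<^sup>-\<^sup>m\<close>, it yields a time \<open>n\<close>
  with \<open>T\<^sup>j\<^sup>+\<^sup>n u \<in> G\<close> and some \<open>w \<in> U\<close> with \<open>T\<^sup>j\<^sup>-\<^sup>m\<^sup>+\<^sup>n w \<in> V\<close>. Counted from the visit \<open>T\<^sup>m u \<in> U\<close>,
  both happen at the same time \<open>j - m + n\<close>. The strict inequality \<open>m < j\<close> makes that time positive, as
  thickness requires.\<close>

lemma simultaneous_hitting:
  fixes X :: "'a::metric_space set"
  assumes "continuous_on X T" "T ` X = X" "u \<in> X" "z \<in> X"
    and hit: "\<And>G U V. \<lbrakk>neighborhood X z G; opene X U; opene X V\<rbrakk> \<Longrightarrow>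
        hit_point T u G \<inter> hit_sets T U V \<noteq> {}"
    and U: "opene X U" "(T ^^ m) u \<in> U" and "m < j"
    and G: "openin (top_of_set X) G" "(T ^^ j) z \<in> G" and V: "opene X V"
  obtains n where "n \<ge> 1" "n \<in> hit_sets T U G" "n \<in> hit_sets T U V"
proof -
  have "neighborhood X z (X \<inter> (T ^^ j) -` G)"
    unfolding neighborhood_def using openin_vimage_funpow[OF assms(1,2) G(1)] assms(4) G(2) by blast
  moreover have "opene X (X \<inter> (T ^^ (j - m)) -` V)"
    using opene_vimage_funpow[OF assms(1,2) V] .
  ultimately obtain n where n: "(T ^^ j) ((T ^^ n) u) \<in> G"
    and "U \<inter> (T ^^ n) -` (X \<inter> (T ^^ (j - m)) -` V) \<noteq> {}"
    using hit[OF _ U(1)] unfolding hit_point_def hit_sets_def by blast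
  then obtain w where w: "w \<in> U" "(T ^^ (j - m)) ((T ^^ n) w) \<in> V" by blast
  let ?n = "(j - m) + n"
  have "?n + m = j + n" using \<open>m < j\<close> by simp
  then have "(T ^^ ?n) ((T ^^ m) u) \<in> G"
    using n by (metis comp_apply funpow_add)
  then have "?n \<in> hit_sets T U G" using U(2) unfolding hit_sets_def by blast
  moreover have "?n \<in> hit_sets T U V"
    using w unfolding hit_sets_def by (auto simp: funpow_add)
  moreover have "?n \<ge> 1" using \<open>m < j\<close> by simp
  ultimately show thesis using that by blast
qed

section \<open>Thick sensitivity\<close>

theorem theorem4p7:
  fixes X :: "'a::metric_space set" and T :: "'a \<Rightarrow> 'a"
  assumes "dynamical_system X T"
    and "\<not> proximal_system X T"
    and "transitive_compact X T"
  shows "thickly_sensitive X T"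
proof -
  have X: "X \<noteq> {}" "compact X" "continuous_on X T" "T ` X = X"
    using assms(1) by (simp_all add: dynamical_system_def)
  obtain x y where xy: "x \<in> X" "y \<in> X" "\<not> proximal_pair T x y"
    using assms(2) unfolding proximal_system_def by blast
  have tc: "\<exists>z\<in>X. \<forall>G U V. neighborhood X z G \<and> opene X U \<and> opene X V \<longrightarrow>
      hit_point T p G \<inter> hit_sets T U V \<noteq> {}" if "p \<in> X" for p
    using assms(3) that unfolding transitive_compact_def by blast
  have "hit_sets T U V \<noteq> {}" if "opene X U" "opene X V" for U V
  proof -
    have "neighborhood X z X" if "z \<in> X" for z
      using that unfolding neighborhood_def by auto
    then show ?thesis using tc[OF xy(1)] that by blast
  qed
  then obtain u where u: "u \<in> X" "\<And>U. opene X U \<Longrightarrow> \<exists>m. (T ^^ m) u \<in> U"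
    using exists_transitive_point[OF X(2,1,3,4)] by blast
  obtain z where z: "z \<in> X" "\<And>G U V. \<lbrakk>neighborhood X z G; opene X U; opene X V\<rbrakk> \<Longrightarrow>
        hit_point T u G \<inter> hit_sets T U V \<noteq> {}"
    using tc[OF u(1)] by blast
  obtain \<delta> where \<delta>: "\<delta> > 0"
    "\<And>k m. \<exists>j>m. \<exists>v\<in>X. \<forall>i\<le>k. \<delta> < dist ((T ^^ (i + j)) z) ((T ^^ i) v)"
    using not_proximal_pair_imp_escape[OF X(2-4) xy(1,2) z(1) xy(3)] by blast
  \<comment> \<open>Of the separation \<open>\<delta>\<close>, one third is lost at each end when \<open>T\<^sup>j z\<close> and \<open>v\<close> are replaced by points of
    \<open>T\<^sup>n U\<close> near them.\<close>
  have "thick (sensitivity_times T U (\<delta>/3))" if U: "opene X U" for U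
    unfolding thick_def
  proof
    fix k
    obtain m where m: "(T ^^ m) u \<in> U" using u(2)[OF U] by blast
    obtain j v where j: "j > m" and v: "v \<in> X"
      and far: "\<And>i. i \<le> k \<Longrightarrow> \<delta> < dist ((T ^^ (i + j)) z) ((T ^^ i) v)"
      using \<delta>(2) by blast
    let ?a = "(T ^^ j) z"
    have a: "?a \<in> X" using funpow_mem[OF X(4) z(1)] .
    obtain d where d: "d > 0"
      "\<And>a b i. \<lbrakk>a \<in> X; b \<in> X; dist a b < d; i \<le> k\<rbrakk> \<Longrightarrow> dist ((T ^^ i) a) ((T ^^ i) b) < \<delta> / 3"
      using uniformly_close_iterates[OF X(2-4), of "\<delta>/3" k] \<delta>(1) by auto
    obtain n where n: "n \<ge> 1" "n \<in> hit_sets T U (X \<inter> ball ?a d)" "n \<in> hit_sets T U (X \<inter> ball v d)"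
    proof (rule simultaneous_hitting[OF X(3,4) u(1) z U m j])
      show "openin (top_of_set X) (X \<inter> ball ?a d)" "opene X (X \<inter> ball v d)"
        using opene_Int_ball[OF a d(1)] opene_Int_ball[OF v d(1)] by (auto simp: opene_def)
    qed (use a d(1) in auto)
    then obtain p q where p: "p \<in> U" "(T ^^ n) p \<in> X" "dist ?a ((T ^^ n) p) < d"
      and q: "q \<in> U" "(T ^^ n) q \<in> X" "dist v ((T ^^ n) q) < d"
      unfolding hit_sets_def by auto
    have "n + i \<in> sensitivity_times T U (\<delta>/3)" if i: "i \<le> k" for i
    proof -
      let ?S = "T ^^ i"
      have "dist (?S ?a) (?S ((T ^^ n) p)) < \<delta> / 3" "dist (?S v) (?S ((T ^^ n) q)) < \<delta> / 3"
        using d(2) a v p q i by auto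
      moreover have "\<delta> < dist (?S ?a) (?S v)" using far[OF i] by (simp add: funpow_add)
      ultimately have "\<delta> / 3 < dist (?S ((T ^^ n) p)) (?S ((T ^^ n) q))"
        by metric
      then have "\<delta> / 3 < dist ((T ^^ (n + i)) p) ((T ^^ (n + i)) q)"
        by (simp add: funpow_add add.commute[of n])
      then show ?thesis using p(1) q(1) unfolding sensitivity_times_def by blast
    qed
    then have "{n..n + k} \<subseteq> sensitivity_times T U (\<delta>/3)"
      by (metis atLeastAtMost_iff le_add_diff_inverse nat_add_left_cancel_le subsetI)
    then show "\<exists>n\<ge>1. {n..n + k} \<subseteq> sensitivity_times T U (\<delta>/3)"
      using n(1) by blast
  qed
  then show ?thesis
    unfolding thickly_sensitive_def using \<delta>(1) by (meson divide_pos_pos zero_less_numeral)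
qed

end
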